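(* Let $U_1,\dots,U_m\subset\mathbb{R}^n$ be nonempty closed convex sets with $U:=\bigcap_{i=1}^m U_i\neq\emptyset$. Let $(x_k)_{k\ge1}$ be the sequence generated by 3PM for a starting point $x_1\in\mathbb{R}^n$, and let $\bar x\in U$ be its limit. Assume that the error bound condition holds for $\{U_i\}_{i=1}^m$ around $\bar x$, i.e. there exist $\omega\in(0,1)$ and a neighborhood $V$ of $\bar x$ such that $$\omega\,\operatorname{dist}(x,U)\le\max_{1\le i\le m}\operatorname{dist}(x,U_i)\quad\text{for all }x\in V.$$ Then $(x_k)$ converges linearly to $\bar x$.
   Context: $\mathbb{R}^n$ carries the Euclidean inner product and norm; $P_C(x)$ is the projection of $x$ onto a nonempty closed convex set $C$, and $\operatorname{dist}(x,C)=\inf_{y\in C}\|x-y\|$. The sequence generated by 3PM (Parallel Polyhedral Projection Method) from $x_1$ is defined recursively for $k\ge1$ by $$S_{ik}=\{z\in\mathbb{R}^n:\langle x_k-P_{U_i}(x_k),\,z-P_{U_i}(x_k)\rangle\le 0\}\ (i=1,\dots,m),\quad \Omega_k=\bigcap_{i=1}^m S_{ik},\quad x_{k+1}=P_{\Omega_k}(x_k).$$ (If $x_k\in U$, then $x_{k+1}=x_k$, so the sequence is constant from then on.) Every such sequence converges to a point of $U$. Linear convergence of $(x_k)$ to $\bar x$ means: there is $r\in(0,1)$ such that $\|x_{k+1}-\bar x\|\le r\|x_k-\bar x\|$ for all sufficiently large $k$. *)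

theory Defs
  imports "HOL-Analysis.Analysis"
begin

text \<open>
  The projection onto a nonempty closed convex set \<open>C\<close> is \<open>closest_point C\<close>, and the
  distance to a nonempty set \<open>C\<close> is \<open>infdist x C\<close>. Both are total functions, unspecified
  respectively \<open>0\<close> for \<open>C = {}\<close>; the sets used below are nonempty when the closed convex sets \<open>U i\<close>
  have a common point, since then \<open>(\<Inter>i\<in>{1..m}. U i) \<subseteq> threePM_Omega m U y\<close>.
\<close>

text \<open>
  The set \<open>S\<^sub>i\<^sub>k\<close> belonging to \<open>C = U\<^sub>i\<close> and the iterate \<open>y = x\<^sub>k\<close>. It is a half-space if
  \<open>y \<notin> C\<close>, and the whole space if \<open>y \<in> C\<close>.
\<close>

definition supporting_halfspace :: "'a::euclidean_space set \<Rightarrow> 'a \<Rightarrow> 'a set" where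
  "supporting_halfspace C y =
     {z. (y - closest_point C y) \<bullet> (z - closest_point C y) \<le> 0}"

definition threePM_Omega :: "nat \<Rightarrow> (nat \<Rightarrow> 'a::euclidean_space set) \<Rightarrow> 'a \<Rightarrow> 'a set" where
  "threePM_Omega m U y = (\<Inter>i\<in>{1..m}. supporting_halfspace (U i) y)"

text \<open>Sequences are indexed from \<open>1\<close>, so the value \<open>x 0\<close> is irrelevant and unconstrained.\<close>

definition threePM_sequence ::
  "nat \<Rightarrow> (nat \<Rightarrow> 'a::euclidean_space set) \<Rightarrow> (nat \<Rightarrow> 'a) \<Rightarrow> bool" where
  "threePM_sequence m U x \<longleftrightarrow>
     (\<forall>k\<ge>1. x (Suc k) = closest_point (threePM_Omega m U (x k)) (x k))"

text \<open>A neighbourhood of \<open>p\<close> is a set with \<open>p\<close> in its interior; it need not be open.\<close>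

definition error_bound_around ::
  "nat \<Rightarrow> (nat \<Rightarrow> 'a::euclidean_space set) \<Rightarrow> 'a \<Rightarrow> bool" where
  "error_bound_around m U p \<longleftrightarrow>
     (\<exists>\<omega> V. 0 < \<omega> \<and> \<omega> < 1 \<and> p \<in> interior V \<and>
        (\<forall>x\<in>V. \<omega> * infdist x (\<Inter>i\<in>{1..m}. U i) \<le> Max ((\<lambda>i. infdist x (U i)) ` {1..m})))"

definition converges_linearly :: "(nat \<Rightarrow> 'a::real_normed_vector) \<Rightarrow> 'a \<Rightarrow> bool" where
  "converges_linearly x l \<longleftrightarrow>
     (\<exists>r. 0 < r \<and> r < 1 \<and>
        (\<forall>\<^sub>F k in sequentially. norm (x (Suc k) - l) \<le> r * norm (x k - l)))"

end

theory Submission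
  imports Defs
begin

text \<open>
  The projection inequality gives
  \<open>\<parallel>x\<^sub>k\<^sub>+\<^sub>1 - u\<parallel>\<^sup>2 + \<parallel>x\<^sub>k - x\<^sub>k\<^sub>+\<^sub>1\<parallel>\<^sup>2 \<le> \<parallel>x\<^sub>k - u\<parallel>\<^sup>2\<close> for all \<open>u \<in> U\<close>, and the step length is at least
  \<open>dist(x\<^sub>k, U\<^sub>i)\<close> for every \<open>i\<close>, hence at least \<open>\<omega> dist(x\<^sub>k, U)\<close> for large \<open>k\<close>. The distances to
  the projection of \<open>x\<^sub>k\<close> onto \<open>U\<close> decrease from step \<open>k\<close> on, so passing to the limit yields
  \<open>\<parallel>x\<^sub>k - l\<parallel> \<le> 2 dist(x\<^sub>k, U)\<close> for the limit \<open>l\<close>. Taking \<open>u = l\<close> gives the rate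
  \<open>r\<^sup>2 = 1 - \<omega>\<^sup>2/4\<close>.
\<close>

lemma closest_point_pythagoras:
  fixes S :: "'a::euclidean_space set"
  assumes "convex S" "closed S" "u \<in> S"
  shows "(dist (closest_point S a) u)\<^sup>2 + (dist a (closest_point S a))\<^sup>2 \<le> (dist a u)\<^sup>2"
proof -
  let ?c = "closest_point S a"
  have "(a - ?c) \<bullet> (u - ?c) \<le> 0"
    using closest_point_dot[OF assms] .
  moreover have "(dist a u)\<^sup>2 = (dist ?c u)\<^sup>2 + (dist a ?c)\<^sup>2 - 2 * ((a - ?c) \<bullet> (u - ?c))"
    by (simp add: dist_norm power2_norm_eq_inner inner_diff inner_commute)
  ultimately show ?thesis by linarith
qed

text \<open>This form fits the library facts on closed and convex half-spaces, which also cover the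
  zero normal arising for \<open>y \<in> C\<close>.\<close>

lemma supporting_halfspace_eq:
  "supporting_halfspace C y =
     {z. (y - closest_point C y) \<bullet> z \<le> (y - closest_point C y) \<bullet> closest_point C y}"
  by (simp add: supporting_halfspace_def inner_diff_right)

lemma closed_threePM_Omega: "closed (threePM_Omega m U y)"
  by (auto simp: threePM_Omega_def supporting_halfspace_eq intro: closed_halfspace_le)

lemma convex_threePM_Omega: "convex (threePM_Omega m U y)"
  by (auto simp: threePM_Omega_def supporting_halfspace_eq
      intro!: convex_INT convex_halfspace_le)

lemma subset_threePM_Omega:
  assumes "\<And>i. i \<in> {1..m} \<Longrightarrow> closed (U i)" "\<And>i. i \<in> {1..m} \<Longrightarrow> convex (U i)"
  shows "(\<Inter>i\<in>{1..m}. U i) \<subseteq> threePM_Omega m U y"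
  using assms by (auto simp: threePM_Omega_def supporting_halfspace_def intro!: closest_point_dot)

text \<open>The law of cosines at \<open>closest_point C y\<close> shows that no point of the
  half-space is nearer to \<open>y\<close> than this projection.\<close>

lemma infdist_le_dist_supporting_halfspace:
  assumes "closed C" "C \<noteq> {}" "z \<in> supporting_halfspace C y"
  shows "infdist y C \<le> dist y z"
proof -
  let ?c = "closest_point C y"
  have "infdist y C \<le> dist y ?c"
    using assms by (intro infdist_le closest_point_in_set)
  also have "(dist y z)\<^sup>2 = (dist y ?c)\<^sup>2 + (dist z ?c)\<^sup>2 - 2 * ((y - ?c) \<bullet> (z - ?c))"
    by (simp add: dist_norm power2_norm_eq_inner inner_diff inner_commute)
  then have "(dist y ?c)\<^sup>2 \<le> (dist y z)\<^sup>2"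
    using assms(3) zero_le_power2[of "dist z ?c"] unfolding supporting_halfspace_def mem_Collect_eq
    by linarith
  then have "dist y ?c \<le> dist y z"
    by (rule power2_le_imp_le) simp
  finally show ?thesis .
qed

text \<open>From index \<open>k\<close> on, the sequence stays in the closed ball around the
  projection \<open>p\<close> of \<open>x k\<close> with radius \<open>infdist (x k) S\<close>. The
  limit lies in it too, and two points of a ball are at most a diameter apart: hence the factor
  2.\<close>

lemma fejer_monotone_dist_limit_le:
  fixes x :: "nat \<Rightarrow> 'a::heine_borel"
  assumes "closed S" "S \<noteq> {}"
    and mono: "\<And>j u. j \<ge> k \<Longrightarrow> u \<in> S \<Longrightarrow> dist (x (Suc j)) u \<le> dist (x j) u"
    and lim: "x \<longlonglongrightarrow> l"
  shows "dist (x k) l \<le> 2 * infdist (x k) S"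
proof -
  obtain p where p: "p \<in> S" "infdist (x k) S = dist (x k) p"
    using infdist_attains_inf[OF assms(1,2)] by blast
  have "dist (x j) p \<le> dist (x k) p" if "j \<ge> k" for j
    using that
  proof (induction j rule: dec_induct)
    case (step j)
    then show ?case using mono[of j p] p(1) by linarith
  qed simp
  then have "dist l p \<le> dist (x k) p"
    by (intro LIMSEQ_le_const2[OF tendsto_dist[OF lim tendsto_const]]) blast
  then show ?thesis
    using dist_triangle[of "x k" l p] p(2) by (simp add: dist_commute)
qed

theorem theorem2p8:
  fixes m :: nat
    and U :: "nat \<Rightarrow> (real ^ 'n) set"
    and x :: "nat \<Rightarrow> real ^ 'n"
    and xbar :: "real ^ 'n"
  assumes "m \<ge> 1"
    and "\<And>i. i \<in> {1..m} \<Longrightarrow> U i \<noteq> {}"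
    and "\<And>i. i \<in> {1..m} \<Longrightarrow> closed (U i)"
    and "\<And>i. i \<in> {1..m} \<Longrightarrow> convex (U i)"
    and "(\<Inter>i\<in>{1..m}. U i) \<noteq> {}"
    and "threePM_sequence m U x"
    and "xbar \<in> (\<Inter>i\<in>{1..m}. U i)"
    and "x \<longlonglongrightarrow> xbar"
    and "error_bound_around m U xbar"
  shows "converges_linearly x xbar"
proof -
  let ?S = "\<Inter>i\<in>{1..m}. U i"
  let ?\<Omega> = "\<lambda>k. threePM_Omega m U (x k)"
  have S_sub: "?S \<subseteq> ?\<Omega> k" for k
    by (intro subset_threePM_Omega assms(3,4))
  have step: "x (Suc k) = closest_point (?\<Omega> k) (x k)" if "k \<ge> 1" for k
    using assms(6) that unfolding threePM_sequence_def by blast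
  have fejer: "(dist (x (Suc k)) u)\<^sup>2 + (dist (x k) (x (Suc k)))\<^sup>2 \<le> (dist (x k) u)\<^sup>2"
    if "k \<ge> 1" "u \<in> ?S" for k u
    using closest_point_pythagoras[OF convex_threePM_Omega closed_threePM_Omega, of u m U "x k" "x k"]
      subsetD[OF S_sub that(2)] unfolding step[OF that(1)] by blast
  have mono: "dist (x (Suc k)) u \<le> dist (x k) u" if "k \<ge> 1" "u \<in> ?S" for k u
    using fejer[OF that] zero_le_power2[of "dist (x k) (x (Suc k))"]
    by - (rule power2_le_imp_le, linarith, simp)
  have near: "dist (x k) xbar \<le> 2 * infdist (x k) ?S" if "k \<ge> 1" for k
  proof (rule fejer_monotone_dist_limit_le)
    show "closed ?S" using assms(3) by (intro closed_INT) blast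
    show "dist (x (Suc j)) u \<le> dist (x j) u" if "j \<ge> k" "u \<in> ?S" for j u
      using mono[OF _ that(2)] that(1) \<open>k \<ge> 1\<close> by simp
  qed (fact assms)+
  have step_length: "infdist (x k) (U i) \<le> dist (x k) (x (Suc k))"
    if "k \<ge> 1" "i \<in> {1..m}" for k i
  proof (rule infdist_le_dist_supporting_halfspace)
    \<comment> \<open>\<open>closest_point\<close> is only meaningful for a nonempty set; here the
      common points of the \<open>U i\<close> supply an element.\<close>
    have "x (Suc k) \<in> ?\<Omega> k"
      unfolding step[OF that(1)] using S_sub[of k] assms(5)
      by (intro closest_point_in_set closed_threePM_Omega) blast
    then show "x (Suc k) \<in> supporting_halfspace (U i) (x k)"
      using that(2) by (auto simp: threePM_Omega_def)
  qed (use assms(2,3) that in auto)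
  obtain \<omega> V where \<omega>: "0 < \<omega>" "\<omega> < 1" and V: "xbar \<in> interior V"
    and bound: "\<And>y. y \<in> V \<Longrightarrow>
      \<omega> * infdist y ?S \<le> Max ((\<lambda>i. infdist y (U i)) ` {1..m})"
    using assms(9) unfolding error_bound_around_def by blast
  define r where "r = sqrt (1 - \<omega>\<^sup>2 / 4)"
  \<comment> \<open>The upper bound keeps the radicand of \<open>r\<close> positive, the lower one
    makes it less than 1.\<close>
  have \<omega>2: "0 < \<omega>\<^sup>2" "\<omega>\<^sup>2 < 1"
    using \<omega> by (auto simp: power_less_one_iff)
  then have r: "0 < r" "r < 1" "r\<^sup>2 = 1 - \<omega>\<^sup>2 / 4"
    by (auto simp: r_def)
  \<comment> \<open>The error bound is local, so convergence must first bring the tail into the open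
    set \<open>interior V\<close>.\<close>
  have "\<forall>\<^sub>F k in sequentially. x k \<in> interior V"
    using topological_tendstoD[OF assms(8) open_interior V] .
  then have "\<forall>\<^sub>F k in sequentially. norm (x (Suc k) - xbar) \<le> r * norm (x k - xbar)"
    using eventually_ge_at_top[of 1]
  proof eventually_elim
    case (elim k)
    have "\<omega> * infdist (x k) ?S \<le> Max ((\<lambda>i. infdist (x k) (U i)) ` {1..m})"
      using bound elim(1) interior_subset by blast
    \<comment> \<open>\<open>m \<ge> 1\<close> makes the index set nonempty, so that
      \<open>Max\<close> is a genuine maximum.\<close>
    also have "\<dots> \<le> dist (x k) (x (Suc k))"
      using assms(1) step_length[OF elim(2)] by (subst Max_le_iff) auto
    finally have "\<omega> * infdist (x k) ?S \<le> dist (x k) (x (Suc k))" .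
    moreover have "\<omega> * (dist (x k) xbar / 2) \<le> \<omega> * infdist (x k) ?S"
      using near[OF elim(2)] \<omega>(1) by (intro mult_left_mono) auto
    ultimately have "\<omega> * (dist (x k) xbar / 2) \<le> dist (x k) (x (Suc k))"
      by linarith
    then have "(\<omega> * (dist (x k) xbar / 2))\<^sup>2 \<le> (dist (x k) (x (Suc k)))\<^sup>2"
      using \<omega>(1) by (intro power_mono) auto
    then have "(dist (x (Suc k)) xbar)\<^sup>2 \<le> (r * dist (x k) xbar)\<^sup>2"
      using fejer[OF elim(2) assms(7)] by (simp add: power_mult_distrib power_divide r(3) algebra_simps)
    then show ?case
      using power2_le_imp_le[of "dist (x (Suc k)) xbar" "r * dist (x k) xbar"] r(1)
      by (simp add: dist_norm)
  qed
  then show ?thesis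
    unfolding converges_linearly_def using r by blast
qed

end
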